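(* Let $\delta,r\in[0,1)$ and let $A,B$ be sets of functions on $Y$ with $d_{\mathrm{si}L^\infty_w}(A,B)\le r$. Then there exists $\varepsilon\ge 8r$ such that $$ \operatorname{RIP}_B(\delta)\ \Rightarrow\ \operatorname{RIP}_A(\delta+\varepsilon), $$ with $\varepsilon\le 15r$ if $\delta\le\tfrac12$ and $r\le\tfrac14$. For $\delta\le\tfrac12$ and $r\le\tfrac{\delta}{15}$, this implies $$ \operatorname{RIP}_B(\delta)\ \Rightarrow\ \operatorname{RIP}_A(2\delta). $$
   Context: $(Y,\gamma)$ is a probability space and $w\ge0$ is a weight function on $Y$ with $\int_Y w^{-1}\,d\gamma=1$. Put $\|v\|:=\|v\|_{L^2(Y,\gamma)}$ and $\|v\|_{L^\infty_w}:=\|w^{1/2}v\|_{L^\infty(Y,\gamma)}$; all functions considered have finite $\|\cdot\|_{L^\infty_w}$-norm. For given sample points $y^1,\ldots,y^n\in Y$ let $\|v\|_n:=\big(\tfrac1n\sum_{i=1}^nw(y^i)|v(y^i)|^2\big)^{1/2}$; point values are understood so that $w(y^i)^{1/2}|v(y^i)|\le\|v\|_{L^\infty_w}$, hence $\|v\|\le\|v\|_{L^\infty_w}$ and $\|v\|_n\le\|v\|_{L^\infty_w}$. For a set $A$ of functions, $\operatorname{RIP}_A(\delta)$ means $(1-\delta)\|u\|^2\le\|u\|_n^2\le(1+\delta)\|u\|^2$ for all $u\in A$. Distances: $d_{L^\infty_w}(A,B):=\inf_{a\in A}\inf_{b\in B}\|a-b\|_{L^\infty_w}$ and $$ d_{\mathrm{si}L^\infty_w}(A,B):=\sup_{a\in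 A}d_{L^\infty_w}\big(\operatorname{Cone}(a),U(B)\big), $$ where $\operatorname{Cone}(a):=\{ta:t>0\}$ and $U(B):=\{b/\|b\|:b\in B,\ b\neq0\}$. *)

theory Defs
  imports "HOL-Probability.Probability"
begin

(* The value type is instantiated to 'k::{real_normed_field, second_countable_topology}
   in statements, so that real- and complex-valued functions are both covered. *)

(* The reciprocal is taken in ennreal, where inverse 0 = top; with the convention inverse 0 = 0
   of the reals a weight vanishing on a set of positive measure would not be excluded. *)
definition weight :: "'y measure \<Rightarrow> ('y \<Rightarrow> real) \<Rightarrow> bool" where
  "weight M w \<longleftrightarrow> w \<in> borel_measurable M \<and> (\<forall>x\<in>space M. 0 \<le> w x) \<and>
     (\<integral>\<^sup>+x. inverse (ennreal (w x)) \<partial>M) = 1"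

definition L2norm :: "'y measure \<Rightarrow> ('y \<Rightarrow> 'k::real_normed_vector) \<Rightarrow> real" where
  "L2norm M v = sqrt (\<integral>x. (norm (v x))\<^sup>2 \<partial>M)"

definition Linfw :: "'y measure \<Rightarrow> ('y \<Rightarrow> real) \<Rightarrow> ('y \<Rightarrow> 'k::real_normed_vector) \<Rightarrow> ennreal" where
  "Linfw M w v = esssup M (\<lambda>x. ennreal (sqrt (w x) * norm (v x)))"

definition empnorm :: "('y \<Rightarrow> real) \<Rightarrow> nat \<Rightarrow> (nat \<Rightarrow> 'y) \<Rightarrow> ('y \<Rightarrow> 'k::real_normed_vector) \<Rightarrow> real" where
  "empnorm w n y v = sqrt (1 / real n * (\<Sum>i=1..n. w (y i) * (norm (v (y i)))\<^sup>2))"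

(* A real vector space V of representatives on which point evaluation at the sample points is
   compatible with the essential supremum.  Differences t a - b with a, b in V occur
   in the distances below, so the compatibility is needed for them as well. *)
definition function_class ::
    "'y measure \<Rightarrow> ('y \<Rightarrow> real) \<Rightarrow> nat \<Rightarrow> (nat \<Rightarrow> 'y) \<Rightarrow> ('y \<Rightarrow> 'k::real_normed_vector) set \<Rightarrow> bool" where
  "function_class M w n y V \<longleftrightarrow>
     (\<forall>u\<in>V. \<forall>v\<in>V. (\<lambda>x. u x + v x) \<in> V) \<and>
     (\<forall>t. \<forall>v\<in>V. (\<lambda>x. t *\<^sub>R v x) \<in> V) \<and>
     (\<forall>v\<in>V. v \<in> borel_measurable M \<and> Linfw M w v < \<infinity>) \<and>
     (\<forall>v\<in>V. \<forall>i\<in>{1..n}. ennreal (sqrt (w (y i)) * norm (v (y i))) \<le> Linfw M w v)"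

definition RIP ::
    "'y measure \<Rightarrow> ('y \<Rightarrow> real) \<Rightarrow> nat \<Rightarrow> (nat \<Rightarrow> 'y) \<Rightarrow> ('y \<Rightarrow> 'k::real_normed_vector) set \<Rightarrow> real \<Rightarrow> bool" where
  "RIP M w n y A \<delta> \<longleftrightarrow>
     (\<forall>u\<in>A. (1 - \<delta>) * (L2norm M u)\<^sup>2 \<le> (empnorm w n y u)\<^sup>2 \<and>
            (empnorm w n y u)\<^sup>2 \<le> (1 + \<delta>) * (L2norm M u)\<^sup>2)"

definition Cone :: "('y \<Rightarrow> 'k::real_normed_vector) \<Rightarrow> ('y \<Rightarrow> 'k) set" where
  "Cone a = {\<lambda>x. t *\<^sub>R a x | t::real. 0 < t}"

(* b \<noteq> 0 is meant in L^2, i.e. up to null sets. *)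
definition normalized :: "'y measure \<Rightarrow> ('y \<Rightarrow> 'k::real_normed_vector) set \<Rightarrow> ('y \<Rightarrow> 'k) set" where
  "normalized M B = {\<lambda>x. b x /\<^sub>R L2norm M b | b. b \<in> B \<and> \<not> (AE x in M. b x = 0)}"

(* Distances live in ennreal: the infimum over the empty set is top, the supremum 0. *)
definition dist_Linfw ::
    "'y measure \<Rightarrow> ('y \<Rightarrow> real) \<Rightarrow> ('y \<Rightarrow> 'k::real_normed_vector) set \<Rightarrow> ('y \<Rightarrow> 'k) set \<Rightarrow> ennreal" where
  "dist_Linfw M w A B = (INF a\<in>A. INF b\<in>B. Linfw M w (\<lambda>x. a x - b x))"

definition dist_siLinfw ::
    "'y measure \<Rightarrow> ('y \<Rightarrow> real) \<Rightarrow> ('y \<Rightarrow> 'k::real_normed_vector) set \<Rightarrow> ('y \<Rightarrow> 'k) set \<Rightarrow> ennreal" where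
  "dist_siLinfw M w A B = (SUP a\<in>A. dist_Linfw M w (Cone a) (normalized M B))"

end

theory Submission
  imports Defs
begin

text \<open>
  Write \<open>L\<close> for the norm of \<open>L\<^sup>2\<close> and \<open>E\<close> for the discrete norm. Both are seminorms bounded by the
  weighted supremum norm: \<open>E\<close> because point values are, and \<open>L\<close> because \<open>1 / w\<close> has integral one.
  Hence a perturbation of size \<open>R\<close> in the weighted supremum norm changes either of them by at most
  \<open>R\<close>.

  Let \<open>a \<in> A\<close>. The scale-invariant distance provides, for every \<open>R > r\<close>, a multiple \<open>t a\<close> with
  \<open>t > 0\<close> at distance at most \<open>R\<close> from some \<open>u = b / L b\<close> with \<open>b \<in> B\<close>. Here \<open>L u = 1\<close>, and the
  isometry property of \<open>B\<close> puts \<open>E u\<close> between \<open>sqrt (1 - \<delta>)\<close> and \<open>sqrt (1 + \<delta>)\<close>. Therefore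
  \<open>L (t a)\<close> lies in \<open>[1 - R, 1 + R]\<close> and \<open>E (t a)\<close> in
  \<open>[sqrt (1 - \<delta>) - R, sqrt (1 + \<delta>) + R]\<close>. Dividing eliminates \<open>t\<close>, and \<open>R \<rightarrow> r\<close> yields,
  whenever \<open>L a > 0\<close>,
  \<open>(sqrt (1 - \<delta>) - r) / (1 + r) \<le> E a / L a \<le> (sqrt (1 + \<delta>) + r) / (1 - r)\<close>;
  the lemma \<open>RIP_comparison\<close> states this without denominators.

  It remains to square. The lower bound loses at most \<open>4 r\<close> in the isometry constant. The upper bound
  loses \<open>((sqrt (1 + \<delta>) + r) / (1 - r))\<^sup>2 - (1 + \<delta>)\<close>, which is at most \<open>15 r\<close> for
  \<open>\<delta> \<le> 1/2\<close> and \<open>r \<le> 1/4\<close>. So \<open>\<epsilon>\<close> can be taken as the maximum of \<open>8 r\<close> and the latter quantity;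
  this is \<open>RIP_loss \<delta> r\<close>.
\<close>

section \<open>The discrete and the continuous norm\<close>

lemma L2norm_nonneg: "0 \<le> L2norm M v"
  by (simp add: L2norm_def)

lemma L2norm_scaleR: "L2norm M (\<lambda>x. t *\<^sub>R v x) = \<bar>t\<bar> * L2norm M v"
  by (simp add: L2norm_def power_mult_distrib real_sqrt_mult)

text \<open>Young's inequality \<open>(x + y)\<^sup>2 \<le> (1 + q/p) x\<^sup>2 + (1 + p/q) y\<^sup>2\<close>, integrated with \<open>p\<close> and \<open>q\<close>
  the two norms, gives \<open>(p + q)\<^sup>2\<close> on the right. The norms are enlarged a little to make
  \<open>p\<close> and \<open>q\<close> positive.\<close>

lemma L2norm_triangle_ineq:
  fixes f g :: "'y \<Rightarrow> 'k::{real_normed_vector, second_countable_topology}"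
  assumes [measurable]: "f \<in> borel_measurable M" "g \<in> borel_measurable M"
    and f: "integrable M (\<lambda>x. (norm (f x))\<^sup>2)" and g: "integrable M (\<lambda>x. (norm (g x))\<^sup>2)"
  shows "L2norm M (\<lambda>x. f x + g x) \<le> L2norm M f + L2norm M g"
proof (rule field_le_epsilon)
  fix e :: real
  assume "0 < e"
  define p where "p = L2norm M f + e/2"
  define q where "q = L2norm M g + e/2"
  have pos: "0 < p" "0 < q"
    using \<open>0 < e\<close> L2norm_nonneg[of M f] L2norm_nonneg[of M g] by (simp_all add: p_def q_def)
  have "(L2norm M f)\<^sup>2 \<le> p\<^sup>2" "(L2norm M g)\<^sup>2 \<le> q\<^sup>2"
    using \<open>0 < e\<close> L2norm_nonneg[of M f] L2norm_nonneg[of M g]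
    by (simp_all add: p_def q_def power_mono)
  then have sq: "(\<integral>x. (norm (f x))\<^sup>2 \<partial>M) \<le> p\<^sup>2" "(\<integral>x. (norm (g x))\<^sup>2 \<partial>M) \<le> q\<^sup>2"
    by (simp_all add: L2norm_def)
  have young: "(norm (f x + g x))\<^sup>2 \<le> (1 + q/p) * (norm (f x))\<^sup>2 + (1 + p/q) * (norm (g x))\<^sup>2" for x
  proof -
    have "(norm (f x + g x))\<^sup>2 \<le> (norm (f x) + norm (g x))\<^sup>2"
      by (intro power_mono norm_triangle_ineq norm_ge_zero)
    also have "\<dots> = (1 + q/p) * (norm (f x))\<^sup>2 + (1 + p/q) * (norm (g x))\<^sup>2
        - (q * norm (f x) - p * norm (g x))\<^sup>2 / (p * q)"
      using pos by (simp add: field_simps power2_eq_square)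
    also have "\<dots> \<le> (1 + q/p) * (norm (f x))\<^sup>2 + (1 + p/q) * (norm (g x))\<^sup>2"
      using pos by simp
    finally show ?thesis .
  qed
  have int: "integrable M (\<lambda>x. (1 + q/p) * (norm (f x))\<^sup>2 + (1 + p/q) * (norm (g x))\<^sup>2)"
    using f g by simp
  have "(\<integral>x. (norm (f x + g x))\<^sup>2 \<partial>M)
      \<le> (\<integral>x. (1 + q/p) * (norm (f x))\<^sup>2 + (1 + p/q) * (norm (g x))\<^sup>2 \<partial>M)"
    using young abs_ge_self
    by (intro integral_mono Bochner_Integration.integrable_bound[OF int] int)
      (auto intro: order_trans)
  also have "\<dots> = (1 + q/p) * (\<integral>x. (norm (f x))\<^sup>2 \<partial>M) + (1 + p/q) * (\<integral>x. (norm (g x))\<^sup>2 \<partial>M)"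
    using f g by simp
  also have "\<dots> \<le> (1 + q/p) * p\<^sup>2 + (1 + p/q) * q\<^sup>2"
    using sq pos by (intro add_mono mult_left_mono) auto
  also have "\<dots> = (p + q)\<^sup>2"
    using pos by (simp add: field_simps power2_eq_square)
  finally have "L2norm M (\<lambda>x. f x + g x) \<le> p + q"
    using pos by (simp add: L2norm_def real_le_lsqrt)
  then show "L2norm M (\<lambda>x. f x + g x) \<le> L2norm M f + L2norm M g + e"
    by (simp add: p_def q_def)
qed

text \<open>As a finite Euclidean norm of the weighted samples, the discrete norm inherits the
  triangle inequality.\<close>

lemma empnorm_eq_L2_set:
  assumes "\<And>i. i \<in> {1..n} \<Longrightarrow> 0 \<le> w (y i)"
  shows "empnorm w n y v = L2_set (\<lambda>i. sqrt (w (y i) / real n) * norm (v (y i))) {1..n}"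
proof -
  have "(\<Sum>i=1..n. (sqrt (w (y i) / real n) * norm (v (y i)))\<^sup>2)
      = (\<Sum>i=1..n. 1 / real n * (w (y i) * (norm (v (y i)))\<^sup>2))"
    using assms by (intro sum.cong refl) (simp add: power_mult_distrib)
  then show ?thesis
    by (simp add: empnorm_def L2_set_def flip: sum_distrib_left sum_divide_distrib)
qed

lemma empnorm_nonneg:
  assumes "\<And>i. i \<in> {1..n} \<Longrightarrow> 0 \<le> w (y i)"
  shows "0 \<le> empnorm w n y v"
  using assms by (subst empnorm_eq_L2_set) auto

lemma empnorm_scaleR: "empnorm w n y (\<lambda>x. t *\<^sub>R v x) = \<bar>t\<bar> * empnorm w n y v"
proof -
  have "1 / real n * (\<Sum>i=1..n. w (y i) * (norm (t *\<^sub>R v (y i)))\<^sup>2)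
      = t\<^sup>2 * (1 / real n * (\<Sum>i=1..n. w (y i) * (norm (v (y i)))\<^sup>2))"
    by (simp add: power_mult_distrib sum_distrib_left mult_ac)
  then show ?thesis
    unfolding empnorm_def by (simp only: real_sqrt_mult real_sqrt_abs)
qed

lemma empnorm_triangle_ineq:
  assumes w: "\<And>i. i \<in> {1..n} \<Longrightarrow> 0 \<le> w (y i)"
  shows "empnorm w n y (\<lambda>x. f x + g x) \<le> empnorm w n y f + empnorm w n y g"
proof -
  let ?c = "\<lambda>i. sqrt (w (y i) / real n)"
  have "L2_set (\<lambda>i. ?c i * norm (f (y i) + g (y i))) {1..n}
      \<le> L2_set (\<lambda>i. ?c i * norm (f (y i)) + ?c i * norm (g (y i))) {1..n}"
    using w by (intro L2_set_mono)
      (auto simp flip: distrib_left intro!: mult_left_mono norm_triangle_ineq)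
  also have "\<dots> \<le> L2_set (\<lambda>i. ?c i * norm (f (y i))) {1..n} + L2_set (\<lambda>i. ?c i * norm (g (y i))) {1..n}"
    by (rule L2_set_triangle_ineq)
  finally show ?thesis
    by (simp only: empnorm_eq_L2_set[where w = w and y = y, OF w])
qed

section \<open>Both norms are dominated by the weighted supremum norm\<close>

lemma weight_AE_pos:
  assumes "weight M w"
  shows "AE x in M. 0 < w x"
proof -
  have [measurable]: "w \<in> borel_measurable M" and w: "\<And>x. x \<in> space M \<Longrightarrow> 0 \<le> w x"
    and int: "(\<integral>\<^sup>+x. inverse (ennreal (w x)) \<partial>M) = 1"
    using assms by (auto simp: weight_def)
  \<comment> \<open>In the extended reals \<open>inverse 0 = \<infinity>\<close>, so a finite integral excludes zeros of the weight.\<close>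
  have "AE x in M. inverse (ennreal (w x)) \<noteq> \<infinity>"
    using int by (intro nn_integral_PInf_AE) auto
  then show ?thesis
    using AE_space
  proof eventually_elim
    case (elim x)
    then have "w x \<noteq> 0" "0 \<le> w x"
      using w by auto
    then show ?case
      by simp
  qed
qed

lemma weight_has_inverse_integral:
  assumes "weight M w"
  shows "integrable M (\<lambda>x. inverse (w x))" and "(\<integral>x. inverse (w x) \<partial>M) = 1"
proof -
  have [measurable]: "w \<in> borel_measurable M"
    and int: "(\<integral>\<^sup>+x. inverse (ennreal (w x)) \<partial>M) = 1"
    using assms by (auto simp: weight_def)
  have "(\<integral>\<^sup>+x. ennreal (inverse (w x)) \<partial>M) = (\<integral>\<^sup>+x. inverse (ennreal (w x)) \<partial>M)"
    using weight_AE_pos[OF assms]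
    by (intro nn_integral_cong_AE) (auto simp: inverse_ennreal)
  moreover have "AE x in M. 0 \<le> inverse (w x)"
    using weight_AE_pos[OF assms] by eventually_elim simp
  ultimately have "has_bochner_integral M (\<lambda>x. inverse (w x)) 1"
    using int by (intro has_bochner_integral_nn_integral) auto
  then show "integrable M (\<lambda>x. inverse (w x))" and "(\<integral>x. inverse (w x) \<partial>M) = 1"
    by (auto simp: has_bochner_integral_iff)
qed

text \<open>A bound \<open>sqrt w * norm v \<le> R\<close> almost everywhere means \<open>(norm v)\<^sup>2 \<le> R\<^sup>2 / w\<close>,
  and \<open>1 / w\<close> has integral one.\<close>

lemma L2norm_le_Linfw:
  fixes v :: "'y \<Rightarrow> 'k::{real_normed_vector, second_countable_topology}"
  assumes w: "weight M w" and v[measurable]: "v \<in> borel_measurable M"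
    and le: "Linfw M w v \<le> ennreal R" and R: "0 \<le> R"
  shows "integrable M (\<lambda>x. (norm (v x))\<^sup>2)" and "L2norm M v \<le> R"
proof -
  have "AE x in M. ennreal (sqrt (w x) * norm (v x)) \<le> Linfw M w v"
    unfolding Linfw_def by (rule esssup_AE)
  then have bound: "AE x in M. (norm (v x))\<^sup>2 \<le> R\<^sup>2 * inverse (w x)"
    using weight_AE_pos[OF w]
  proof eventually_elim
    case (elim x)
    have "ennreal (sqrt (w x) * norm (v x)) \<le> ennreal R"
      using elim le by (auto intro: order_trans)
    then have "sqrt (w x) * norm (v x) \<le> R"
      using R by simp
    then have "(sqrt (w x) * norm (v x))\<^sup>2 \<le> R\<^sup>2"
      using elim by (intro power_mono) auto
    then show ?case
      using elim by (simp add: power_mult_distrib field_simps)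
  qed
  have int: "integrable M (\<lambda>x. R\<^sup>2 * inverse (w x))"
    using weight_has_inverse_integral[OF w] by simp
  show sq: "integrable M (\<lambda>x. (norm (v x))\<^sup>2)"
    by (rule Bochner_Integration.integrable_bound[OF int]) (use bound in \<open>auto intro: order_trans\<close>)
  have "(\<integral>x. (norm (v x))\<^sup>2 \<partial>M) \<le> (\<integral>x. R\<^sup>2 * inverse (w x) \<partial>M)"
    by (rule integral_mono_AE[OF sq int bound])
  also have "\<dots> = R\<^sup>2"
    using weight_has_inverse_integral[OF w] by simp
  finally show "L2norm M v \<le> R"
    using R by (simp add: L2norm_def real_le_lsqrt)
qed

lemma function_class_square_integrable:
  fixes V :: "('y \<Rightarrow> 'k::{real_normed_vector, second_countable_topology}) set"
  assumes "weight M w" "function_class M w n y V" "v \<in> V"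
  shows "integrable M (\<lambda>x. (norm (v x))\<^sup>2)"
proof -
  have "v \<in> borel_measurable M" "Linfw M w v < \<infinity>"
    using assms by (auto simp: function_class_def)
  then show ?thesis
    using L2norm_le_Linfw(1)[OF assms(1), of v "enn2real (Linfw M w v)"] by simp
qed

lemma empnorm_le_Linfw:
  assumes "1 \<le> n" and w: "\<And>i. i \<in> {1..n} \<Longrightarrow> 0 \<le> w (y i)"
    and le: "\<And>i. i \<in> {1..n} \<Longrightarrow> sqrt (w (y i)) * norm (v (y i)) \<le> R" and R: "0 \<le> R"
  shows "empnorm w n y v \<le> R"
proof -
  have "w (y i) * (norm (v (y i)))\<^sup>2 \<le> R\<^sup>2" if "i \<in> {1..n}" for i
  proof -
    have "(sqrt (w (y i)) * norm (v (y i)))\<^sup>2 \<le> R\<^sup>2"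
      using le[OF that] w[OF that] by (intro power_mono) auto
    then show ?thesis
      using w[OF that] by (simp add: power_mult_distrib)
  qed
  then have "(\<Sum>i=1..n. w (y i) * (norm (v (y i)))\<^sup>2) \<le> real (card {1..n}) * R\<^sup>2"
    by (intro sum_bounded_above)
  then have "1 / real n * (\<Sum>i=1..n. w (y i) * (norm (v (y i)))\<^sup>2) \<le> R\<^sup>2"
    using \<open>1 \<le> n\<close> by (simp add: field_simps)
  then show ?thesis
    using R by (simp add: empnorm_def real_le_lsqrt)
qed

section \<open>Comparison of the two norms across the scale-invariant distance\<close>

text \<open>The infima in the distance need not be attained, hence the slack \<open>e\<close>.\<close>

lemma dist_siLinfw_approximant:
  assumes "dist_siLinfw M w A B \<le> ennreal r" "a \<in> A" "0 \<le> r" "0 < e"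
  obtains t b where "0 < t" "b \<in> B" "\<not> (AE x in M. b x = 0)"
    "Linfw M w (\<lambda>x. t *\<^sub>R a x - b x /\<^sub>R L2norm M b) \<le> ennreal (r + e)"
proof -
  have "dist_Linfw M w (Cone a) (normalized M B) \<le> dist_siLinfw M w A B"
    unfolding dist_siLinfw_def using assms by (intro SUP_upper)
  also have "\<dots> < ennreal (r + e)"
    using assms by (intro le_less_trans[OF assms(1)]) (simp add: ennreal_less_iff)
  finally show ?thesis
    unfolding dist_Linfw_def Cone_def normalized_def
    by (auto simp: INF_less_iff intro: that less_imp_le)
qed

lemma le_if_le_perturbed:
  fixes l k c :: real
  assumes "\<And>e. 0 < e \<Longrightarrow> l \<le> k + e * c"
  shows "l \<le> k"
proof (rule tendsto_lowerbound)
  show "((\<lambda>e. k + e * c) \<longlongrightarrow> k) (at_right 0)"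
    by (auto intro!: tendsto_eq_intros)
  show "\<forall>\<^sub>F e in at_right 0. l \<le> k + e * c"
    using assms by (auto simp: eventually_at_right_less intro: eventually_mono[OF eventually_at_right_less])
qed simp

text \<open>The ratio bound for \<open>E a / L a\<close>, with denominators cleared. In this form it covers \<open>L a = 0\<close>
  as well.\<close>

lemma RIP_comparison:
  fixes V A B :: "('y \<Rightarrow> 'k::{real_normed_vector, second_countable_topology}) set"
  assumes wt: "weight M w" and n: "1 \<le> n" and y: "\<And>i. i \<in> {1..n} \<Longrightarrow> y i \<in> space M"
    and V: "function_class M w n y V" and "A \<subseteq> V" "B \<subseteq> V"
    and \<delta>: "\<delta> \<in> {0..<1}" and r: "0 \<le> r"
    and d: "dist_siLinfw M w A B \<le> ennreal r" and RIP: "RIP M w n y B \<delta>" and a: "a \<in> A"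
  shows "(1 - r) * empnorm w n y a \<le> (sqrt (1 + \<delta>) + r) * L2norm M a"
    and "(sqrt (1 - \<delta>) - r) * L2norm M a \<le> (1 + r) * empnorm w n y a"
proof -
  let ?E = "empnorm w n y" and ?L = "L2norm M"
  have w: "0 \<le> w (y i)" if "i \<in> {1..n}" for i
    using wt y[OF that] by (auto simp: weight_def)
  have "a \<in> V"
    using a \<open>A \<subseteq> V\<close> by auto
  have scale: "(\<lambda>x. t *\<^sub>R v x) \<in> V" if "v \<in> V" for t v
    using V that by (auto simp: function_class_def)
  have add: "(\<lambda>x. u x + v x) \<in> V" if "u \<in> V" "v \<in> V" for u v
    using V that by (auto simp: function_class_def)
  have meas: "v \<in> borel_measurable M" if "v \<in> V" for v
    using V that by (auto simp: function_class_def)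
  have L_tri: "?L (\<lambda>x. u x + v x) \<le> ?L u + ?L v" if "u \<in> V" "v \<in> V" for u v
    using that by (intro L2norm_triangle_ineq meas function_class_square_integrable[OF wt V])
  have E_tri: "?E (\<lambda>x. u x + v x) \<le> ?E u + ?E v" for u v :: "'y \<Rightarrow> 'k"
    using w by (intro empnorm_triangle_ineq)
  have nonneg: "0 \<le> ?L a" "0 \<le> ?E a"
    using w by (auto intro: L2norm_nonneg empnorm_nonneg)
  have both: "(1 - (r + e)) * ?E a \<le> (sqrt (1 + \<delta>) + (r + e)) * ?L a \<and>
      (sqrt (1 - \<delta>) - (r + e)) * ?L a \<le> (1 + (r + e)) * ?E a" if e: "0 < e" for e
  proof -
    define R where "R = r + e"
    have R: "0 \<le> R"
      using r e by (simp add: R_def)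
    obtain t b where t: "0 < t" and b: "b \<in> B" "\<not> (AE x in M. b x = 0)"
      and near: "Linfw M w (\<lambda>x. t *\<^sub>R a x - b x /\<^sub>R ?L b) \<le> ennreal R"
      by (rule dist_siLinfw_approximant[OF d a r e, folded R_def])
    \<comment> \<open>\<open>h\<close> is the difference \<open>f - u\<close>, written as a combination so that the closure properties of
      the vector space \<open>V\<close> apply.\<close>
    define f where "f = (\<lambda>x. t *\<^sub>R a x)"
    define u where "u = (\<lambda>x. b x /\<^sub>R ?L b)"
    define h where "h = (\<lambda>x. f x + (-1) *\<^sub>R u x)"
    have "b \<in> V"
      using b \<open>B \<subseteq> V\<close> by auto
    have fV: "f \<in> V"
      unfolding f_def by (rule scale[OF \<open>a \<in> V\<close>])
    have uV: "u \<in> V"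
      unfolding u_def by (rule scale[OF \<open>b \<in> V\<close>])
    have hV: "h \<in> V"
      unfolding h_def by (rule add[OF fV scale[OF uV]])
    have near_h: "Linfw M w h \<le> ennreal R"
      using near by (simp add: h_def u_def f_def)
    have L_h: "?L h \<le> R"
      using L2norm_le_Linfw(2)[OF wt meas near_h R] hV by simp
    have E_h: "?E h \<le> R"
    proof (rule empnorm_le_Linfw[where w = w and y = y, OF n w _ R])
      fix i assume i: "i \<in> {1..n}"
      then have "ennreal (sqrt (w (y i)) * norm (h (y i))) \<le> Linfw M w h"
        using V hV by (auto simp: function_class_def)
      from order_trans[OF this near_h] show "sqrt (w (y i)) * norm (h (y i)) \<le> R"
        using R by simp
    qed
    have b_pos: "0 < ?L b"
    proof -
      have [measurable]: "b \<in> borel_measurable M"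
        using meas \<open>b \<in> V\<close> .
      have "(\<integral>x. (norm (b x))\<^sup>2 \<partial>M) \<noteq> 0"
        using b(2) function_class_square_integrable[OF wt V \<open>b \<in> V\<close>]
        by (subst integral_nonneg_eq_0_iff_AE) auto
      then show ?thesis
        by (simp add: L2norm_def less_le)
    qed
    have L_u: "?L u = 1"
      using b_pos by (simp add: u_def L2norm_scaleR)
    have E_u: "?E u = ?E b / ?L b"
      using b_pos by (simp add: u_def empnorm_scaleR field_simps)
    have E_u_sq: "1 - \<delta> \<le> (?E u)\<^sup>2" "(?E u)\<^sup>2 \<le> 1 + \<delta>"
      using RIP b(1) b_pos by (auto simp: RIP_def E_u power_divide field_simps)
    have E_u_bounds: "sqrt (1 - \<delta>) \<le> ?E u" "?E u \<le> sqrt (1 + \<delta>)"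
      using E_u_sq w by (auto intro!: real_le_lsqrt real_le_rsqrt empnorm_nonneg)
    have f_eq: "(\<lambda>x. h x + u x) = f" and u_eq: "(\<lambda>x. f x + (-1) *\<^sub>R h x) = u"
      by (simp_all add: h_def)
    have L_t: "?L f = t * ?L a" and L_neg: "?L (\<lambda>x. (-1) *\<^sub>R h x) = ?L h"
      unfolding f_def using t by (subst L2norm_scaleR, simp)+
    have E_t: "?E f = t * ?E a" and E_neg: "?E (\<lambda>x. (-1) *\<^sub>R h x) = ?E h"
      unfolding f_def using t by (subst empnorm_scaleR, simp)+
    have L_f: "1 - R \<le> t * ?L a" "t * ?L a \<le> 1 + R"
      using L_tri[OF hV uV] L_tri[OF fV scale[OF hV, of "-1"]] L_h
      unfolding f_eq u_eq L_t L_neg L_u by linarith+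
    have E_f: "sqrt (1 - \<delta>) - R \<le> t * ?E a" "t * ?E a \<le> sqrt (1 + \<delta>) + R"
      using E_tri[of h u] E_tri[of f "\<lambda>x. (-1) *\<^sub>R h x"] E_h E_u_bounds
      unfolding f_eq u_eq E_t E_neg by linarith+
    \<comment> \<open>The bounds for \<open>t * ?L a\<close> and \<open>t * ?E a\<close> are multiplied crosswise. This needs the factors
      \<open>1 - R\<close> and \<open>sqrt (1 - \<delta>) - R\<close> to be nonnegative; otherwise the left-hand sides are not
      positive.\<close>
    have "t * ((1 - R) * ?E a) \<le> t * ((sqrt (1 + \<delta>) + R) * ?L a)"
    proof (cases "R \<le> 1")
      case True
      have "(1 - R) * (t * ?E a) \<le> (1 - R) * (sqrt (1 + \<delta>) + R)"
        using True E_f by (intro mult_left_mono) auto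
      also have "\<dots> \<le> (t * ?L a) * (sqrt (1 + \<delta>) + R)"
        using L_f R \<delta> by (intro mult_right_mono) auto
      finally show ?thesis
        by (simp add: algebra_simps)
    next
      case False
      have "(1 - R) * ?E a \<le> 0"
        using False nonneg by (intro mult_nonpos_nonneg) auto
      moreover have "0 \<le> (sqrt (1 + \<delta>) + R) * ?L a"
        using R \<delta> nonneg by auto
      ultimately show ?thesis
        using t by (intro mult_left_mono) linarith+
    qed
    moreover have "t * ((sqrt (1 - \<delta>) - R) * ?L a) \<le> t * ((1 + R) * ?E a)"
    proof (cases "R \<le> sqrt (1 - \<delta>)")
      case True
      have "(sqrt (1 - \<delta>) - R) * (t * ?L a) \<le> (sqrt (1 - \<delta>) - R) * (1 + R)"
        using True L_f by (intro mult_left_mono) auto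
      also have "\<dots> \<le> (t * ?E a) * (1 + R)"
        using E_f R by (intro mult_right_mono) auto
      finally show ?thesis
        by (simp add: algebra_simps)
    next
      case False
      have "(sqrt (1 - \<delta>) - R) * ?L a \<le> 0"
        using False nonneg by (intro mult_nonpos_nonneg) auto
      moreover have "0 \<le> (1 + R) * ?E a"
        using R nonneg by auto
      ultimately show ?thesis
        using t by (intro mult_left_mono) linarith+
    qed
    ultimately show ?thesis
      using t by (simp add: R_def)
  qed
  show "(1 - r) * ?E a \<le> (sqrt (1 + \<delta>) + r) * ?L a"
  proof (rule le_if_le_perturbed)
    fix e :: real assume "0 < e"
    from both[OF this] show "(1 - r) * ?E a \<le> (sqrt (1 + \<delta>) + r) * ?L a + e * (?L a + ?E a)"
      by (simp add: algebra_simps)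
  qed
  show "(sqrt (1 - \<delta>) - r) * ?L a \<le> (1 + r) * ?E a"
  proof (rule le_if_le_perturbed)
    fix e :: real assume "0 < e"
    from both[OF this] show "(sqrt (1 - \<delta>) - r) * ?L a \<le> (1 + r) * ?E a + e * (?L a + ?E a)"
      by (simp add: algebra_simps)
  qed
qed

section \<open>The loss in the isometry constant\<close>

text \<open>The second argument of the maximum is the least constant for which squaring the upper ratio
  bound gives \<open>E\<^sup>2 \<le> (1 + \<delta> + \<epsilon>) L\<^sup>2\<close>.\<close>

definition RIP_loss :: "real \<Rightarrow> real \<Rightarrow> real" where
  "RIP_loss \<delta> r = max (8 * r) (((sqrt (1 + \<delta>) + r) / (1 - r))\<^sup>2 - (1 + \<delta>))"

lemma RIP_loss_upper:
  assumes "r < 1" "0 \<le> p" "(1 - r) * p \<le> (sqrt (1 + \<delta>) + r) * q"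
  shows "p\<^sup>2 \<le> (1 + (\<delta> + RIP_loss \<delta> r)) * q\<^sup>2"
proof -
  have "p \<le> (sqrt (1 + \<delta>) + r) / (1 - r) * q"
    using assms by (simp add: field_simps)
  then have "p\<^sup>2 \<le> ((sqrt (1 + \<delta>) + r) / (1 - r) * q)\<^sup>2"
    using assms by (intro power_mono)
  also have "\<dots> = ((sqrt (1 + \<delta>) + r) / (1 - r))\<^sup>2 * q\<^sup>2"
    by (rule power_mult_distrib)
  also have "\<dots> \<le> (1 + (\<delta> + RIP_loss \<delta> r)) * q\<^sup>2"
    by (intro mult_right_mono) (auto simp: RIP_loss_def)
  finally show ?thesis .
qed

text \<open>Already \<open>4 r\<close> suffices below: with \<open>s = sqrt (1 - \<delta>) \<le> 1\<close> one has
  \<open>s\<^sup>2 - 4 r \<le> ((s - r) / (1 + r))\<^sup>2\<close> for \<open>r \<le> s\<close>, whereas for \<open>s < r\<close> the left-hand side is negative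
  and there is nothing to show.\<close>

lemma RIP_loss_lower:
  assumes \<delta>: "\<delta> \<in> {0..<1}" and r: "0 \<le> r" and "0 \<le> q"
    and le: "(sqrt (1 - \<delta>) - r) * q \<le> (1 + r) * p"
  shows "(1 - (\<delta> + RIP_loss \<delta> r)) * q\<^sup>2 \<le> p\<^sup>2"
proof -
  define s where "s = sqrt (1 - \<delta>)"
  have s: "0 \<le> s" "s \<le> 1" "s\<^sup>2 = 1 - \<delta>"
    using \<delta> by (auto simp: s_def)
  have "(1 - (\<delta> + RIP_loss \<delta> r)) * q\<^sup>2 \<le> (s\<^sup>2 - 4 * r) * q\<^sup>2"
    using s r by (intro mult_right_mono) (auto simp: RIP_loss_def)
  also have "\<dots> \<le> p\<^sup>2"
  proof (cases "r \<le> s")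
    case True
    have "(s - r)\<^sup>2 - (s\<^sup>2 - 4 * r) * (1 + r)\<^sup>2
        = (2 * r + r\<^sup>2) * (1 - s\<^sup>2) + 2 * r * (1 - s) + 8 * r\<^sup>2 + 4 * r ^ 3"
      by (simp add: power2_eq_square power3_eq_cube algebra_simps)
    also have "\<dots> \<ge> 0"
      using s(1,2) r by (intro add_nonneg_nonneg mult_nonneg_nonneg) (auto simp: power_le_one)
    finally have "(s\<^sup>2 - 4 * r) * (1 + r)\<^sup>2 \<le> (s - r)\<^sup>2"
      by simp
    then have "(s\<^sup>2 - 4 * r) * (1 + r)\<^sup>2 * q\<^sup>2 \<le> (s - r)\<^sup>2 * q\<^sup>2"
      by (intro mult_right_mono) auto
    also have "\<dots> = ((s - r) * q)\<^sup>2"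
      by (rule power_mult_distrib[symmetric])
    also have "\<dots> \<le> ((1 + r) * p)\<^sup>2"
      using le True \<open>0 \<le> q\<close> by (intro power_mono) (auto simp: s_def)
    also have "\<dots> = p\<^sup>2 * (1 + r)\<^sup>2"
      by (simp add: power_mult_distrib)
    finally have "(s\<^sup>2 - 4 * r) * q\<^sup>2 * (1 + r)\<^sup>2 \<le> p\<^sup>2 * (1 + r)\<^sup>2"
      by (simp add: mult_ac)
    then show ?thesis
      using r by (simp add: mult_le_cancel_right)
  next
    case False
    have "s\<^sup>2 \<le> s"
      using s(1,2) by (simp add: power2_eq_square mult_left_le_one_le)
    then have "s\<^sup>2 - 4 * r \<le> 0"
      using False r by simp
    then have "(s\<^sup>2 - 4 * r) * q\<^sup>2 \<le> 0"
      by (intro mult_nonpos_nonneg) auto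
    then show ?thesis
      by (rule order_trans) simp
  qed
  finally show ?thesis .
qed

text \<open>With \<open>s = sqrt (1 + \<delta>)\<close>, the difference \<open>((s + r) / (1 - r))\<^sup>2 - s\<^sup>2\<close> is \<open>r\<close> times
  \<open>(2 s + 2 s\<^sup>2 + r (1 - s\<^sup>2)) / (1 - r)\<^sup>2\<close>. Since \<open>1 \<le> s \<le> 5/4\<close>, \<open>s\<^sup>2 \<le> 3/2\<close> and \<open>1 - r \<ge> 3/4\<close>, this
  factor is at most \<open>(5/2 + 3) / (9/16) < 10\<close>, so that the constant 15 leaves ample room.\<close>

lemma RIP_loss_le:
  assumes \<delta>: "\<delta> \<in> {0..1/2}" and r: "r \<in> {0..1/4}"
  shows "RIP_loss \<delta> r \<le> 15 * r"
proof -
  define s where "s = sqrt (1 + \<delta>)"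
  have s: "1 \<le> s" "s\<^sup>2 = 1 + \<delta>"
    using \<delta> by (auto simp: s_def)
  have "s \<le> 5/4"
    unfolding s_def using \<delta> by (intro real_le_lsqrt) (auto simp: power2_eq_square)
  have sq: "(3/4)\<^sup>2 \<le> (1 - r)\<^sup>2"
    using r by (intro power_mono) auto
  have "(s + r)\<^sup>2 - s\<^sup>2 * (1 - r)\<^sup>2 = r * (2 * s + 2 * s\<^sup>2 + r * (1 - s\<^sup>2))"
    by (simp add: power2_eq_square algebra_simps)
  also have "\<dots> \<le> r * (5/2 + 3 + 0)"
    using r \<delta> s \<open>s \<le> 5/4\<close> by (intro mult_left_mono add_mono mult_nonneg_nonpos) auto
  also have "\<dots> \<le> r * (15 * (3/4)\<^sup>2)"
    using r by (intro mult_left_mono) (auto simp: power2_eq_square)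
  also have "\<dots> \<le> r * (15 * (1 - r)\<^sup>2)"
    using r sq by (intro mult_left_mono) auto
  finally have "(s + r)\<^sup>2 \<le> (s\<^sup>2 + 15 * r) * (1 - r)\<^sup>2"
    by (simp add: algebra_simps)
  then have "((s + r) / (1 - r))\<^sup>2 \<le> s\<^sup>2 + 15 * r"
    using r by (simp add: power_divide divide_le_eq)
  then show ?thesis
    using r s by (simp add: RIP_loss_def s_def)
qed

lemma RIP_mono:
  assumes "RIP M w n y A \<delta>" "\<delta> \<le> \<delta>'"
  shows "RIP M w n y A \<delta>'"
  unfolding RIP_def
proof (intro ballI conjI)
  fix u assume u: "u \<in> A"
  have "(1 - \<delta>') * (L2norm M u)\<^sup>2 \<le> (1 - \<delta>) * (L2norm M u)\<^sup>2"
    using assms by (intro mult_right_mono) auto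
  then show "(1 - \<delta>') * (L2norm M u)\<^sup>2 \<le> (empnorm w n y u)\<^sup>2"
    using assms u by (force simp: RIP_def)
  have "(1 + \<delta>) * (L2norm M u)\<^sup>2 \<le> (1 + \<delta>') * (L2norm M u)\<^sup>2"
    using assms by (intro mult_right_mono) auto
  then show "(empnorm w n y u)\<^sup>2 \<le> (1 + \<delta>') * (L2norm M u)\<^sup>2"
    using assms u by (force simp: RIP_def)
qed

theorem theorem52:
  fixes M :: "'y measure" and w :: "'y \<Rightarrow> real"
    and n :: nat and y :: "nat \<Rightarrow> 'y"
    and V A B :: "('y \<Rightarrow> 'k::{real_normed_field, second_countable_topology}) set"
    and \<delta> r :: real
  assumes "prob_space M" and "weight M w"
    and "1 \<le> n" and "\<And>i. i \<in> {1..n} \<Longrightarrow> y i \<in> space M"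
    and "function_class M w n y V" and "A \<subseteq> V" and "B \<subseteq> V"
    and "\<delta> \<in> {0..<1}" and "r \<in> {0..<1}"
    and "dist_siLinfw M w A B \<le> ennreal r"
  shows "(\<exists>\<epsilon>\<ge>8 * r. (RIP M w n y B \<delta> \<longrightarrow> RIP M w n y A (\<delta> + \<epsilon>)) \<and>
             (\<delta> \<le> 1/2 \<and> r \<le> 1/4 \<longrightarrow> \<epsilon> \<le> 15 * r))
       \<and> (\<delta> \<le> 1/2 \<and> r \<le> \<delta> / 15 \<longrightarrow> RIP M w n y B \<delta> \<longrightarrow> RIP M w n y A (2 * \<delta>))"
proof -
  have r: "0 \<le> r" "r < 1" and \<delta>: "0 \<le> \<delta>"
    using assms by auto
  have w: "0 \<le> w (y i)" if "i \<in> {1..n}" for i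
    using assms(2) assms(4)[OF that] by (auto simp: weight_def)
  have transfer: "RIP M w n y A (\<delta> + RIP_loss \<delta> r)" if RIP: "RIP M w n y B \<delta>"
    unfolding RIP_def
  proof (intro ballI conjI)
    fix a assume a: "a \<in> A"
    note cmp = RIP_comparison[OF assms(2,3,4,5,6,7,8) r(1) assms(10) RIP a]
    show "(1 - (\<delta> + RIP_loss \<delta> r)) * (L2norm M a)\<^sup>2 \<le> (empnorm w n y a)\<^sup>2"
      by (rule RIP_loss_lower[OF assms(8) r(1) L2norm_nonneg cmp(2)])
    show "(empnorm w n y a)\<^sup>2 \<le> (1 + (\<delta> + RIP_loss \<delta> r)) * (L2norm M a)\<^sup>2"
      using w by (intro RIP_loss_upper[OF r(2) _ cmp(1)] empnorm_nonneg)
  qed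
  have small: "RIP_loss \<delta> r \<le> 15 * r" if "\<delta> \<le> 1/2" "r \<le> 1/4"
    using that r \<delta> by (intro RIP_loss_le) auto
  have "RIP M w n y A (2 * \<delta>)" if "\<delta> \<le> 1/2" "r \<le> \<delta> / 15" "RIP M w n y B \<delta>"
    using small that by (intro RIP_mono[OF transfer]) auto
  moreover have "8 * r \<le> RIP_loss \<delta> r"
    by (simp add: RIP_loss_def)
  ultimately show ?thesis
    using transfer small by (intro conjI exI[where x = "RIP_loss \<delta> r"]) auto
qed

end
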